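(* The approximation ratio of algorithm NG for SRMA is $\Omega(\sqrt{k})$, even when the sum $\sum_j w^{(i)}_j$ of the function weights is the same for each agent $i$. That is, there is an absolute constant $c>0$ such that for all sufficiently large $k$ there is an instance $I$ of SRMA with $k$ agents, in which $\sum_j w^{(i)}_j$ is the same for all agents $i$, on which algorithm NG outputs a permutation $\pi$ with $$\max_{i\in[k]}\sum_{j} w^{(i)}_j\,\mathrm{cov}(f^{(i)}_j,\pi)\ \ge\ c\sqrt{k}\cdot\mathrm{OPT}(I).$$
   Context: **SRMA (min-max submodular ranking for multiple agents).** An instance consists of a ground set $U=[n]$, $k$ agents $a_1,\dots,a_k$, and for each agent $a_i$, monotone submodular functions $f^{(i)}_1,\dots,f^{(i)}_m:2^{[n]}\to[0,1]$ with $f^{(i)}_j(U)=1$ and weights $w^{(i)}_j>0$. For a permutation $\pi$ of $U$, the cover time $\mathrm{cov}(f,\pi)$ is the smallest index $t\in\{1,\dots,n\}$ such that $f$ has value $1$ on the set of the first $t$ elements of $\pi$. The objective value of $\pi$ is $\max_{i\in[k]}\sum_{j=1}^m w^{(i)}_j\mathrm{cov}(f^{(i)}_j,\pi)$; $\mathrm{OPT}(I)$ is its minimum over all permutations. **Algorithm NG (normalized greedy).** View all $m\cdot k$ functions as one single collection. Select elements one at a time: if $S$ is the set of elements chosen so far and $\mathcal F$ is the set of functions $f$ (among all agents) with $f(S)<1$, choose next an element $e\in U\setminus S$ maximizing $\sum_{f\in\mathcal F} w_f\cdot\frac{f(S\cup\{e\})-f(S)}{1-f(S)}$, where $w_f$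 is the weight of $f$. The order of selection is the output permutation (elements remaining after all functions are covered are appended arbitrarily). *)

theory Defs
  imports Complex_Main "HOL-Combinatorics.Multiset_Permutations"
begin

record srma =
  num_elems :: nat
  num_agents :: nat
  num_funs :: nat
  fn :: "nat \<Rightarrow> nat \<Rightarrow> nat set \<Rightarrow> real"  \<comment> \<open>agent, function index, set\<close>
  wt :: "nat \<Rightarrow> nat \<Rightarrow> real"

definition ground :: "srma \<Rightarrow> nat set" where
  "ground I = {1..num_elems I}"

definition submodular_on :: "'a set \<Rightarrow> ('a set \<Rightarrow> real) \<Rightarrow> bool" where
  "submodular_on U f \<longleftrightarrow> (\<forall>A\<subseteq>U. \<forall>B\<subseteq>U. f (A \<union> B) + f (A \<inter> B) \<le> f A + f B)"

text \<open>
  The three sizes are required to be positive: otherwise cover times or the maximum over agents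
  are undefined, or every objective value is zero. Nothing is assumed about the value of a
  function on the empty set (other than that it lies in the unit interval).
\<close>

definition srma_instance :: "srma \<Rightarrow> bool" where
  "srma_instance I \<longleftrightarrow>
     num_elems I \<ge> 1 \<and> num_agents I \<ge> 1 \<and> num_funs I \<ge> 1 \<and>
     (\<forall>i\<in>{1..num_agents I}. \<forall>j\<in>{1..num_funs I}.
        (\<forall>A\<subseteq>ground I. fn I i j A \<in> {0..1}) \<and>
        mono_on (Pow (ground I)) (fn I i j) \<and>
        submodular_on (ground I) (fn I i j) \<and>
        fn I i j (ground I) = 1 \<and>
        wt I i j > 0)"

text \<open>
  A permutation of the ground set is a list containing every element exactly once. The cover time
  ranges over prefix lengths that are at least 1, even for a function with value 1 on the empty set.
\<close>

definition cov :: "(nat set \<Rightarrow> real) \<Rightarrow> nat list \<Rightarrow> nat" where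
  "cov f p = (LEAST t. t \<in> {1..length p} \<and> f (set (take t p)) = 1)"

definition agent_cost :: "srma \<Rightarrow> nat list \<Rightarrow> nat \<Rightarrow> real" where
  "agent_cost I p i = (\<Sum>j=1..num_funs I. wt I i j * real (cov (fn I i j) p))"

definition objective :: "srma \<Rightarrow> nat list \<Rightarrow> real" where
  "objective I p = Max (agent_cost I p ` {1..num_agents I})"

definition OPT :: "srma \<Rightarrow> real" where
  "OPT I = Min (objective I ` permutations_of_set (ground I))"

text \<open>
  The functions of all agents are merged into one family. It is indexed by pairs, so that
  extensionally equal functions are counted with their multiplicity and their own weights.
\<close>

definition uncovered :: "srma \<Rightarrow> nat set \<Rightarrow> (nat \<times> nat) set" where
  "uncovered I S = {(i, j) \<in> {1..num_agents I} \<times> {1..num_funs I}. fn I i j S < 1}"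

definition ng_gain :: "srma \<Rightarrow> nat set \<Rightarrow> nat \<Rightarrow> real" where
  "ng_gain I S e = (\<Sum>(i, j)\<in>uncovered I S.
     wt I i j * ((fn I i j (S \<union> {e}) - fn I i j S) / (1 - fn I i j S)))"

text \<open>
  The algorithm is nondeterministic: the predicate holds for every permutation that it can output
  under some way of breaking ties and of appending the elements left once all functions are covered.
\<close>

definition ng_output :: "srma \<Rightarrow> nat list \<Rightarrow> bool" where
  "ng_output I p \<longleftrightarrow>
     p \<in> permutations_of_set (ground I) \<and>
     (\<forall>t<length p. let S = set (take t p) in
        uncovered I S \<noteq> {} \<longrightarrow> is_arg_max (ng_gain I S) (\<lambda>e. e \<in> ground I - S) (p ! t))"

end

(*
  Let s = floor (sqrt k). Agent 1 puts almost all of its weight, s - 1, on a function that only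
  element 1 covers. Every other agent puts weight s - 1 on a function covered by the first element,
  whichever it is, and weight 1 on a function covered by one of the elements 2, ..., s; at least s
  agents wait for each of these. As s > s - 1, greedy takes element 1 last and agent 1 pays about
  s * s. Taking element 1 first costs agent 1 only s, and the other agents pay at most
  (s - 1) + s in any order.
*)
theory Submission
  imports Defs
begin

section \<open>Greedy runs, gains and cover times of arbitrary instances\<close>

text \<open>A nonempty finite set of remaining elements always has a maximizer, so a run can be
  extended until the ground set is exhausted. This keeps a bound for all outputs from being
  vacuous.\<close>

lemma ng_output_exists: "\<exists>p. ng_output I p"
proof -
  \<comment> \<open>Maximality is demanded at every position, even after all functions are covered.
    This is stronger than \<open>ng_output\<close> and avoids a case split in the induction.\<close>
  define greedy where "greedy p \<longleftrightarrow> distinct p \<and> set p \<subseteq> ground I \<and>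
     (\<forall>t<length p. is_arg_max (ng_gain I (set (take t p)))
        (\<lambda>e. e \<in> ground I - set (take t p)) (p ! t))" for p
  have fin: "finite (ground I)" and card: "card (ground I) = num_elems I"
    by (auto simp: ground_def)
  have "\<exists>p. length p = t \<and> greedy p" if "t \<le> num_elems I" for t
    using that
  proof (induction t)
    case 0
    show ?case by (auto simp: greedy_def)
  next
    case (Suc t)
    then obtain p where p: "length p = t" "greedy p" by auto
    define R where "R = ground I - set p"
    have "card (set p) < card (ground I)"
      using p Suc.prems card by (auto simp: greedy_def distinct_card)
    then have R: "finite R" "R \<noteq> {}"
      using fin card_mono[of "set p" "ground I"] by (auto simp: R_def)
    have "Max (ng_gain I (set p) ` R) \<in> ng_gain I (set p) ` R"
      using R by (intro Max_in) auto
    then obtain x where "x \<in> R" "ng_gain I (set p) x = Max (ng_gain I (set p) ` R)"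
      by force
    then have x: "is_arg_max (ng_gain I (set p)) (\<lambda>e. e \<in> R) x"
      using R by (auto simp: is_arg_max_linorder)
    then have "x \<in> R" by (simp add: is_arg_max_def)
    have "greedy (p @ [x])"
      using p x \<open>x \<in> R\<close> by (auto simp: greedy_def R_def nth_append less_Suc_eq)
    then show ?case using p by (intro exI[of _ "p @ [x]"]) auto
  qed
  then obtain p where p: "length p = num_elems I" "greedy p" by blast
  then have "set p = ground I"
    using fin card by (intro card_subset_eq) (auto simp: greedy_def distinct_card)
  then show ?thesis
    using p by (intro exI[of _ p]) (auto simp: ng_output_def greedy_def Let_def)
qed

text \<open>Summands of covered functions vanish because division by zero yields zero.\<close>

lemma ng_gain_sum_all:
  assumes "\<And>i j. i \<in> {1..num_agents I} \<Longrightarrow> j \<in> {1..num_funs I} \<Longrightarrow> fn I i j S \<le> 1"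
  shows "ng_gain I S e = (\<Sum>i=1..num_agents I. \<Sum>j=1..num_funs I.
     wt I i j * ((fn I i j (S \<union> {e}) - fn I i j S) / (1 - fn I i j S)))"
  unfolding ng_gain_def sum.cartesian_product
proof (rule sum.mono_neutral_left)
  show "\<forall>x\<in>{1..num_agents I} \<times> {1..num_funs I} - uncovered I S. (case x of (i, j) \<Rightarrow>
    wt I i j * ((fn I i j (S \<union> {e}) - fn I i j S) / (1 - fn I i j S))) = 0"
  proof clarify
    fix i j assume "i \<in> {1..num_agents I}" "j \<in> {1..num_funs I}" "(i, j) \<notin> uncovered I S"
    then have "fn I i j S = 1"
      using assms[of i j] by (simp add: uncovered_def)
    then show "wt I i j * ((fn I i j (S \<union> {e}) - fn I i j S) / (1 - fn I i j S)) = 0"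
      by simp
  qed
qed (auto simp: uncovered_def)

lemma cov_le:
  assumes "1 \<le> t" "t \<le> length p" "f (set (take t p)) = 1"
  shows "cov f p \<le> t"
  unfolding cov_def using assms by (intro Least_le) auto

text \<open>The full length of \<open>p\<close> is a witness, so the \<open>LEAST\<close> in
  \<open>cov\<close> is attained.\<close>

lemma cov_props:
  assumes "p \<noteq> []" "f (set p) = 1"
  shows "cov f p \<in> {1..length p}" "f (set (take (cov f p) p)) = 1"
proof -
  have "length p \<in> {1..length p} \<and> f (set (take (length p) p)) = 1"
    using assms by (auto simp: Suc_le_eq)
  from LeastI[of "\<lambda>t. t \<in> {1..length p} \<and> f (set (take t p)) = 1", OF this]
  show "cov f p \<in> {1..length p}" "f (set (take (cov f p) p)) = 1"
    by (auto simp: cov_def)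
qed

section \<open>The hard instance\<close>

text \<open>The element that the second function of agent \<open>i\<close> waits for. Agents from 2
  on form consecutive blocks of length \<open>s\<close>, one for each of 2, 3, ...;
  \<open>min\<close> assigns all agents after the last block to \<open>s\<close>.\<close>

definition target :: "nat \<Rightarrow> nat \<Rightarrow> nat" where
  "target s i = (if i = 1 then 1 else min s (2 + (i - 2) div s))"

text \<open>The first function of agent 1 only pads its total weight to \<open>s\<close>, the total
  of every other agent.\<close>

definition hard_instance :: "nat \<Rightarrow> nat \<Rightarrow> srma" where
  "hard_instance k s = \<lparr>num_elems = s, num_agents = k, num_funs = 2,
     fn = (\<lambda>i j S. if j = 1 then of_bool (S \<noteq> {}) else of_bool (target s i \<in> S)),
     wt = (\<lambda>i j. if (i = 1) = (j = 1) then 1 else real s - 1)\<rparr>"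

lemma hard_instance_simps [simp]:
  "num_elems (hard_instance k s) = s"
  "num_agents (hard_instance k s) = k"
  "num_funs (hard_instance k s) = 2"
  "ground (hard_instance k s) = {1..s}"
  by (simp_all add: hard_instance_def ground_def)

lemma sum_upto_2: "(\<Sum>j=1..2. g j) = g 1 + g (2::nat)"
  by (simp add: numeral_2_eq_2)

lemma target_in_ground: "2 \<le> s \<Longrightarrow> target s i \<in> {1..s}"
  by (auto simp: target_def)

lemma target_eq_1_iff: "2 \<le> s \<Longrightarrow> target s i = 1 \<longleftrightarrow> i = 1"
  by (auto simp: target_def min_def)

text \<open>The block of \<open>b\<close> starts at \<open>2 + (b - 2) * s\<close>, and its last
  agent is \<open>1 + (b - 1) * s <= 1 + (s - 1) * s <= s ^ 2 <= k\<close>.\<close>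

lemma card_target_ge:
  assumes b: "b \<in> {2..s}" and k: "s ^ 2 \<le> k"
  shows "s \<le> card {i \<in> {1..k}. target s i = b}"
proof -
  have "target s i = b \<and> i \<in> {1..k}" if i: "i \<in> {2 + (b - 2) * s..<2 + (b - 2) * s + s}" for i
  proof -
    have "(i - 2) div s = b - 2"
      using i by (intro div_nat_eqI) (auto simp: algebra_simps)
    moreover have "(b - 2) * s + s = (b - 1) * s"
      using b by (cases b) (auto simp: algebra_simps)
    moreover have "(b - 1) * s \<le> (s - 1) * s"
      using b by (intro mult_le_mono1) auto
    moreover have "(s - 1) * s + s = s ^ 2"
      using b by (cases s) (auto simp: power2_eq_square)
    ultimately have "i \<le> k" "min s (2 + (i - 2) div s) = b"
      using i b k unfolding atLeastAtMost_iff atLeastLessThan_iff by linarith+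
    then show ?thesis using i by (auto simp: target_def)
  qed
  then have "card {2 + (b - 2) * s..<2 + (b - 2) * s + s} \<le> card {i \<in> {1..k}. target s i = b}"
    by (intro card_mono) auto
  then show ?thesis by simp
qed

lemma srma_instance_hard:
  assumes "2 \<le> s" "1 \<le> k"
  shows "srma_instance (hard_instance k s)"
proof -
  let ?I = "hard_instance k s"
  have "fn ?I i j A \<in> {0..1}" "wt ?I i j > 0" "fn ?I i j {1..s} = 1" for i j A
    using assms target_in_ground[OF assms(1), of i] by (auto simp: hard_instance_def)
  moreover have "mono_on (Pow {1..s}) (fn ?I i j)" for i j
    by (rule mono_onI) (auto simp: hard_instance_def)
  moreover have "submodular_on {1..s} (fn ?I i j)" for i j
    by (simp add: submodular_on_def hard_instance_def of_bool_def)
  ultimately show ?thesis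
    using assms unfolding srma_instance_def hard_instance_simps by simp
qed

section \<open>Greedy on the hard instance\<close>

text \<open>All values are 0 or 1, so normalization divides by 1 on uncovered functions. The first
  summand does not depend on \<open>e\<close>: only second functions distinguish candidates.\<close>

lemma ng_gain_hard:
  assumes s: "2 \<le> s" and e: "e \<notin> S"
  shows "ng_gain (hard_instance k s) S e =
    (\<Sum>i=1..k. of_bool (S = {}) * wt (hard_instance k s) i 1) +
    (\<Sum>i | i \<in> {1..k} \<and> target s i = e. wt (hard_instance k s) i 2)"
proof -
  let ?I = "hard_instance k s"
  have "ng_gain ?I S e =
    (\<Sum>i=1..k. of_bool (S = {}) * wt ?I i 1 + (if target s i = e then wt ?I i 2 else 0))"
  proof (subst ng_gain_sum_all)
    show "fn ?I i j S \<le> 1" for i j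
      by (simp add: hard_instance_def)
    show "(\<Sum>i=1..num_agents ?I. \<Sum>j=1..num_funs ?I.
        wt ?I i j * ((fn ?I i j (S \<union> {e}) - fn ?I i j S) / (1 - fn ?I i j S))) =
      (\<Sum>i=1..k. of_bool (S = {}) * wt ?I i 1 + (if target s i = e then wt ?I i 2 else 0))"
      unfolding hard_instance_simps sum_upto_2
      using e by (intro sum.cong) (auto simp: hard_instance_def)
  qed
  then show ?thesis
    by (simp only: sum.distrib sum.inter_filter finite_atLeastAtMost)
qed

lemma ng_output_hard_late:
  assumes s: "2 \<le> s" and k: "s ^ 2 \<le> k"
    and p: "ng_output (hard_instance k s) p" and t: "t < length p" "p ! t = 1"
  shows "t = s - 1"
proof (rule ccontr)
  let ?I = "hard_instance k s"
  define S where "S = set (take t p)"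
  assume neq: "t \<noteq> s - 1"
  have perm: "distinct p" "set p = {1..s}"
    using p by (auto simp: ng_output_def permutations_of_set_def)
  then have len: "length p = s" using distinct_card[of p] by simp
  have "p = take t p @ 1 # drop (Suc t) p"
    using id_take_nth_drop[OF t(1)] t(2) by simp
  then have "distinct (take t p @ 1 # drop (Suc t) p)"
    using perm by simp
  then have "1 \<notin> S"
    by (simp add: S_def)
  have "1 \<le> k"
    using s k by (cases "k = 0") auto
  \<comment> \<open>Positions count from 0, so \<open>t\<close> is also the size of
    \<open>S\<close>. As \<open>t < s - 1\<close>, some element other than 1 is still
    available.\<close>
  have "card S < card {2..s}"
    using perm t len neq by (auto simp: S_def distinct_card)
  then obtain b where b: "b \<in> {2..s}" "b \<notin> S"
    by (metis card_mono S_def List.finite_set not_le subsetI)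
  \<comment> \<open>\<open>ng_output\<close> constrains the choice only while some function is
    uncovered; the one waiting for 1 is.\<close>
  have "(1, 2) \<in> uncovered ?I S"
    using \<open>1 \<notin> S\<close> \<open>1 \<le> k\<close> by (auto simp: uncovered_def hard_instance_def target_def)
  then have "is_arg_max (ng_gain ?I S) (\<lambda>e. e \<in> ground ?I - S) 1"
    using p t by (auto simp: ng_output_def S_def Let_def)
  then have "ng_gain ?I S b \<le> ng_gain ?I S 1"
    using b by (auto simp: is_arg_max_linorder)
  moreover have "(\<Sum>i | i \<in> {1..k} \<and> target s i = b. wt ?I i 2) =
      (\<Sum>i | i \<in> {1..k} \<and> target s i = b. 1)"
    using b by (intro sum.cong) (auto simp: hard_instance_def target_def)
  moreover have "{i. i \<in> {1..k} \<and> target s i = 1} = {1}"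
    using \<open>1 \<le> k\<close> target_eq_1_iff[OF s] by auto
  then have "(\<Sum>i | i \<in> {1..k} \<and> target s i = 1. wt ?I i 2) = real s - 1"
    by (simp add: hard_instance_def)
  \<comment> \<open>The contribution of the first functions is equal on both sides and
    cancels.\<close>
  ultimately have "real (card {i \<in> {1..k}. target s i = b}) \<le> real s - 1"
    using b \<open>1 \<notin> S\<close> by (simp add: ng_gain_hard[OF s])
  then show False
    using card_target_ge[OF b(1) k] by linarith
qed

lemma objective_ng_output_hard_ge:
  assumes s: "2 \<le> s" and k: "s ^ 2 \<le> k" and p: "ng_output (hard_instance k s) p"
  shows "(real s - 1) * real s \<le> objective (hard_instance k s) p"
proof -
  let ?I = "hard_instance k s"
  have perm: "distinct p" "set p = {1..s}"
    using p by (auto simp: ng_output_def permutations_of_set_def)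
  then have len: "length p = s" using distinct_card[of p] by simp
  have "1 \<le> k"
    using s k by (cases "k = 0") auto
  have f: "fn ?I 1 2 = (\<lambda>S. of_bool (1 \<in> S))"
    by (auto simp: hard_instance_def target_def fun_eq_iff)
  let ?c = "cov (fn ?I 1 2) p"
  have c: "1 \<in> set (take ?c p)" "?c \<le> length p"
  proof -
    have "p \<noteq> []" using len s by auto
    then show "1 \<in> set (take ?c p)" "?c \<le> length p"
      using cov_props[of p "fn ?I 1 2"] perm s unfolding f by auto
  qed
  \<comment> \<open>The 0-based position of 1 lies strictly below the cover time, so position
    \<open>s - 1\<close> forces cover time \<open>s\<close>.\<close>
  then obtain t where t: "t < ?c" "p ! t = 1"
    by (auto simp: in_set_conv_nth)
  then have "t = s - 1"
    using ng_output_hard_late[OF s k p, of t] c by auto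
  then have "?c = s"
    using t c len by auto
  then have "(real s - 1) * real s \<le> agent_cost ?I p 1"
    by (simp only: agent_cost_def hard_instance_simps sum_upto_2) (simp add: hard_instance_def)
  also have "\<dots> \<le> objective ?I p"
    unfolding objective_def using \<open>1 \<le> k\<close> by (intro Max_ge) auto
  finally show ?thesis .
qed

section \<open>The optimum and the ratio\<close>

text \<open>The increasing order starts with 1: agent 1 then pays at most \<open>s\<close>, and any
  other agent at most \<open>(s - 1) + s\<close>.\<close>

lemma OPT_hard_le:
  assumes s: "2 \<le> s" and k: "1 \<le> k"
  shows "OPT (hard_instance k s) \<le> 2 * real s"
proof -
  let ?I = "hard_instance k s" and ?p = "[1..<Suc s]"
  have perm: "?p \<in> permutations_of_set {1..s}"
    by (rule permutations_of_setI) auto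
  have take1: "set (take 1 ?p) = {1}"
    using s by (auto simp: upt_conv_Cons)
  have c1: "cov (fn ?I i 1) ?p \<le> 1" for i
    by (rule cov_le) (use s take1 in \<open>auto simp: hard_instance_def\<close>)
  have c2: "cov (fn ?I i 2) ?p \<le> s" for i
    by (rule cov_le) (use s target_in_ground[OF s, of i] in \<open>auto simp: hard_instance_def\<close>)
  have c3: "cov (fn ?I 1 2) ?p \<le> 1"
    by (rule cov_le) (use s take1 in \<open>auto simp: hard_instance_def target_def\<close>)
  have "agent_cost ?I ?p i \<le> 2 * real s" for i
  proof (cases "i = 1")
    case True
    have "agent_cost ?I ?p i = real (cov (fn ?I 1 1) ?p) + (real s - 1) * real (cov (fn ?I 1 2) ?p)"
      using True by (simp only: agent_cost_def hard_instance_simps sum_upto_2) (simp add: hard_instance_def)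
    also have "\<dots> \<le> 1 + (real s - 1) * 1"
      using c1[of 1] c3 s by (intro add_mono mult_left_mono) auto
    finally show ?thesis using s by simp
  next
    case False
    have "agent_cost ?I ?p i = (real s - 1) * real (cov (fn ?I i 1) ?p) + real (cov (fn ?I i 2) ?p)"
      using False by (simp only: agent_cost_def hard_instance_simps sum_upto_2) (simp add: hard_instance_def)
    also have "\<dots> \<le> (real s - 1) * 1 + real s"
      using c1[of i] c2[of i] s by (intro add_mono mult_left_mono) auto
    finally show ?thesis by simp
  qed
  then have "objective ?I ?p \<le> 2 * real s"
    using k by (auto simp: objective_def)
  moreover have "OPT ?I \<le> objective ?I ?p"
    unfolding OPT_def using perm by (intro Min_le) (simp_all del: upt_Suc)
  ultimately show ?thesis by linarith
qed

theorem theorem1: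
  shows "\<exists>c::real. c > 0 \<and> (\<forall>\<^sub>F k in sequentially. \<exists>I.
    srma_instance I \<and> num_agents I = k \<and>
    (\<exists>W. \<forall>i\<in>{1..k}. (\<Sum>j=1..num_funs I. wt I i j) = W) \<and>
    (\<exists>p. ng_output I p) \<and>
    (\<forall>p. ng_output I p \<longrightarrow> objective I p \<ge> c * sqrt (real k) * OPT I))"
\<comment> \<open>The constant 1/8 is the product of 1/2, from \<open>OPT <= 2 * s\<close>, and 1/4,
  from \<open>s - 1 >= sqrt k / 4\<close>.\<close>
proof (intro exI[of _ "1/8"] conjI eventually_sequentiallyI[of 16])
  fix k :: nat assume k: "16 \<le> k"
  define s where "s = nat \<lfloor>sqrt (real k)\<rfloor>"
  have "4 \<le> sqrt (real k)"
    using k by (intro real_le_rsqrt) auto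
  then have s: "real s \<le> sqrt (real k)" "sqrt (real k) < real s + 1" "2 \<le> s"
    unfolding s_def by linarith+
  have "real s ^ 2 \<le> real k"
    using power_mono[OF s(1), of 2] by simp
  then have sk: "s ^ 2 \<le> k"
    by (metis of_nat_le_iff of_nat_power)
  let ?I = "hard_instance k s"
  have "(1/8) * sqrt (real k) * OPT ?I \<le> objective ?I p" if p: "ng_output ?I p" for p
  proof -
    have "(1/8) * sqrt (real k) * OPT ?I \<le> (1/8) * sqrt (real k) * (2 * real s)"
      using OPT_hard_le[OF s(3), of k] k by (intro mult_left_mono) auto
    also have "\<dots> = (sqrt (real k) / 4) * real s"
      by simp
    \<comment> \<open>\<open>sqrt k < s + 1\<close>, and \<open>(s + 1) / 4 <= s - 1\<close> because
      \<open>s >= 2\<close>.\<close>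
    also have "\<dots> \<le> (real s - 1) * real s"
      using s by (intro mult_right_mono) auto
    also have "\<dots> \<le> objective ?I p"
      by (rule objective_ng_output_hard_ge[OF s(3) sk p])
    finally show ?thesis .
  qed
  moreover have "(\<Sum>j=1..num_funs ?I. wt ?I i j) = real s" for i
    by (simp only: hard_instance_simps sum_upto_2) (simp add: hard_instance_def)
  ultimately show "\<exists>I. srma_instance I \<and> num_agents I = k \<and>
    (\<exists>W. \<forall>i\<in>{1..k}. (\<Sum>j=1..num_funs I. wt I i j) = W) \<and>
    (\<exists>p. ng_output I p) \<and>
    (\<forall>p. ng_output I p \<longrightarrow> objective I p \<ge> 1/8 * sqrt (real k) * OPT I)"
    using srma_instance_hard[OF s(3), of k] ng_output_exists k
    by (intro exI[of _ ?I]) auto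
qed simp

end
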